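(* Let $n\ge0$ and $d\ge1$ be integers. (a) The polynomial $U_{n,d}$ is obtained by applying to the product $$\prod_{i=0}^{n-1}(x_i+\cdots+x_2+x_1+x_0)^d$$ in the commutative polynomial ring $\mathbb{Z}[x_0,x_1,\ldots,x_n]$ the $\mathbb{Z}$-linear map $\mathbb{Z}[x_0,x_1,\ldots,x_n]\to R\langle t\rangle$ defined on the monomial basis by $$x_n^{\alpha_n}x_{n-1}^{\alpha_{n-1}}\cdots x_1^{\alpha_1}x_0^k\longmapsto y_{\alpha_n}y_{\alpha_{n-1}}\cdots y_{\alpha_1}t^k.$$ (b) Let $\mathsf{PD}_{n,d}$ be the set of all partial maps $f:[n]\times[d]\to[n]$ such that $f(i,j)<i$ for all $(i,j)\in\operatorname{Dom}(f)$. Then $$U_{n,d}=\sum_{f\in\mathsf{PD}_{n,d}}\left(\prod_{i=1}^n y_{\#f^{-1}(\{i\})}\right)t^{\,nd-\#\operatorname{Dom}(f)}.$$ (c) For $F=(T_1,\ldots,T_d)\in\mathsf{T}_n^d$ set $\operatorname{ch}(i;F)=\sum_{j=1}^d\operatorname{ch}(i;T_j)$. Then $$U_{n,d}=\sum_{F\in\mathsf{T}_n^d}\left(\prod_{i=1}^n y_{\operatorname{ch}(i;F)}\right)t^{\operatorname{ch}(0;F)}.$$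
   Context: $[n]=\{1,\ldots,n\}$, $[0]=\emptyset$. A partial map $g$ from a set $X$ to a set $Y$ is a map from a subset $\operatorname{Dom}(g)\subseteq X$ to $Y$; $\#$ denotes cardinality. $\mathsf{T}_n$ is the set of all increasing rooted trees with vertex set $\{0,1,\ldots,n\}$: trees rooted at $0$ in which each node $j\in[n]$ has a father with label smaller than $j$. $\operatorname{ch}(i;T)$ is the number of children of node $i$ in $T$. $\mathsf{T}_n^d$ is the set of $d$-tuples of elements of $\mathsf{T}_n$. Let $R=\mathbb{Z}[y_i;\ i\geq 0]$ be the commutative polynomial ring, and let $R\langle t\rangle$ be the unital ring generated over $\mathbb{Z}$ by $t$ and the $y_i$, subject only to $y_iy_j=y_jy_i$ for all $i,j\ge0$ (so $t$ does not commute with the $y_i$). Let $\Delta$ be the derivation of $R\langle t\rangle$ (additive, satisfying the Leibniz rule) with $\Delta(y_i)=y_{i+1}$ for all $i\ge0$ and $\Delta(t)=0$, and let $\rho_t$ be right multiplication by $t$. For $d\ge1$ define $U_{0,d}=1$ and $U_{n+1,d}=y_0(\Delta+\rho_t)^dU_{n,d}$ for $n\ge0$. *)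

theory Defs
  imports "HOL-Library.Poly_Mapping" "HOL-Library.FuncSet"
begin

text \<open>
  For a monoid \<open>'k\<close> (written additively), \<open>'k \<Rightarrow>\<^sub>0 int\<close> is its monoid ring over the integers, with
  basis the elements \<open>frag_of k\<close>. The map \<open>lin_ext g\<close> is the \<open>\<int>\<close>-linear map
  sending \<open>frag_of k\<close> to \<open>g k\<close>.
\<close>

definition lin_ext :: "('k \<Rightarrow> 'b::ring_1) \<Rightarrow> ('k \<Rightarrow>\<^sub>0 int) \<Rightarrow> 'b" where
  "lin_ext g p = (\<Sum>k\<in>Poly_Mapping.keys p. of_int (Poly_Mapping.lookup p k) * g k)"

lemma lin_ext_0 [simp]: "lin_ext g 0 = 0"
  by (simp add: lin_ext_def)

lemma lin_ext_frag_of [simp]: "lin_ext g (frag_of k) = g k"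
  by (simp add: lin_ext_def)

lemma lin_ext_superset:
  assumes "finite A" "Poly_Mapping.keys p \<subseteq> A"
  shows "lin_ext g p = (\<Sum>k\<in>A. of_int (Poly_Mapping.lookup p k) * g k)"
  unfolding lin_ext_def using assms by (intro sum.mono_neutral_left) (auto simp: in_keys_iff)

lemma lin_ext_diff: "lin_ext g (p - q) = lin_ext g p - lin_ext g q"
proof -
  let ?A = "Poly_Mapping.keys p \<union> Poly_Mapping.keys q"
  have "Poly_Mapping.keys (p - q) \<subseteq> ?A" by (rule keys_diff)
  then show ?thesis
    using lin_ext_superset[of ?A p g] lin_ext_superset[of ?A q g] lin_ext_superset[of ?A "p - q" g]
    by (simp add: lookup_minus left_diff_distrib sum_subtractf)
qed

lemma lin_ext_uminus: "lin_ext g (- p) = - lin_ext g p"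
  using lin_ext_diff[of g 0 p] by simp

lemma lin_ext_add: "lin_ext g (p + q) = lin_ext g p + lin_ext g q"
  using lin_ext_diff[of g p "- q"] by (simp add: lin_ext_uminus)

datatype letter = Let_t | Let_y nat

text \<open>The free monoid on the letters, written additively as required by the monoid ring.\<close>

datatype word = Word (letters: "letter list")

instantiation word :: monoid_add
begin
definition zero_word :: word where "zero_word = Word []"
definition plus_word :: "word \<Rightarrow> word \<Rightarrow> word" where
  "plus_word u v = Word (letters u @ letters v)"
instance by standard (auto simp: zero_word_def plus_word_def)
end

text \<open>The free unital ring \<open>\<int>\<langle>t, y\<^sub>0, y\<^sub>1, \<dots>\<rangle>\<close>.\<close>

type_synonym free_ring = "word \<Rightarrow>\<^sub>0 int"

abbreviation free_letter :: "letter \<Rightarrow> free_ring" where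
  "free_letter a \<equiv> frag_of (Word [a])"

text \<open>The two-sided ideal generated by the elements \<open>y\<^sub>i y\<^sub>j - y\<^sub>j y\<^sub>i\<close>.\<close>

inductive_set comm_ideal :: "free_ring set" where
  zero: "0 \<in> comm_ideal"
| gen: "free_letter (Let_y i) * free_letter (Let_y j)
          - free_letter (Let_y j) * free_letter (Let_y i) \<in> comm_ideal"
| diff: "a \<in> comm_ideal \<Longrightarrow> b \<in> comm_ideal \<Longrightarrow> a - b \<in> comm_ideal"
| mult_left: "a \<in> comm_ideal \<Longrightarrow> r * a \<in> comm_ideal"
| mult_right: "a \<in> comm_ideal \<Longrightarrow> a * r \<in> comm_ideal"

lemma comm_ideal_uminus: "a \<in> comm_ideal \<Longrightarrow> - a \<in> comm_ideal"
  using comm_ideal.diff[OF comm_ideal.zero] by fastforce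

lemma comm_ideal_add: "a \<in> comm_ideal \<Longrightarrow> b \<in> comm_ideal \<Longrightarrow> a + b \<in> comm_ideal"
  using comm_ideal.diff[OF _ comm_ideal_uminus] by fastforce

definition ideal_cong :: "free_ring \<Rightarrow> free_ring \<Rightarrow> bool" where
  "ideal_cong a b \<longleftrightarrow> a - b \<in> comm_ideal"

lemma equivp_ideal_cong: "equivp ideal_cong"
proof (rule equivpI)
  show "reflp ideal_cong"
    by (auto simp: reflp_def ideal_cong_def comm_ideal.zero)
  show "symp ideal_cong"
    using comm_ideal_uminus by (fastforce simp: symp_def ideal_cong_def)
  show "transp ideal_cong"
    unfolding transp_def ideal_cong_def using comm_ideal_add by fastforce
qed

text \<open>
  To see that the quotient is not the zero ring, use the augmentation that sends every letter to \<open>1\<close>.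
\<close>

abbreviation augmentation :: "free_ring \<Rightarrow> int" where
  "augmentation \<equiv> lin_ext (\<lambda>_. 1)"

lemma augmentation_mult: "augmentation (p * q) = augmentation p * augmentation q"
proof (induction p rule: frag_induction[OF subset_UNIV])
  case (2 u)
  show ?case
    by (induction q rule: frag_induction[OF subset_UNIV])
      (simp_all add: lin_ext_diff right_diff_distrib mult_single)
qed (simp_all add: lin_ext_diff left_diff_distrib)

lemma augmentation_comm_ideal: "a \<in> comm_ideal \<Longrightarrow> augmentation a = 0"
  by (induction rule: comm_ideal.induct) (simp_all add: lin_ext_diff augmentation_mult)

text \<open>The ring \<open>R\<langle>t\<rangle>\<close>, as the quotient of the free ring by this ideal.\<close>

quotient_type Rt = free_ring / ideal_cong
  by (rule equivp_ideal_cong)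

instantiation Rt :: ring_1
begin

lift_definition zero_Rt :: Rt is 0 .
lift_definition one_Rt :: Rt is 1 .

lift_definition plus_Rt :: "Rt \<Rightarrow> Rt \<Rightarrow> Rt" is "(+)"
  unfolding ideal_cong_def
proof -
  fix a b c d :: free_ring
  assume "a - b \<in> comm_ideal" "c - d \<in> comm_ideal"
  then have "(a - b) + (c - d) \<in> comm_ideal" by (rule comm_ideal_add)
  then show "(a + c) - (b + d) \<in> comm_ideal" by (simp add: algebra_simps)
qed

lift_definition uminus_Rt :: "Rt \<Rightarrow> Rt" is uminus
  unfolding ideal_cong_def
proof -
  fix a b :: free_ring
  assume "a - b \<in> comm_ideal"
  then have "- (a - b) \<in> comm_ideal" by (rule comm_ideal_uminus)
  then show "- a - - b \<in> comm_ideal" by simp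
qed

lift_definition minus_Rt :: "Rt \<Rightarrow> Rt \<Rightarrow> Rt" is "(-)"
  unfolding ideal_cong_def
proof -
  fix a b c d :: free_ring
  assume "a - b \<in> comm_ideal" "c - d \<in> comm_ideal"
  then have "(a - b) - (c - d) \<in> comm_ideal" by (rule comm_ideal.diff)
  then show "(a - c) - (b - d) \<in> comm_ideal" by (simp add: algebra_simps)
qed

lift_definition times_Rt :: "Rt \<Rightarrow> Rt \<Rightarrow> Rt" is "(*)"
  unfolding ideal_cong_def
proof -
  fix a b c d :: free_ring
  assume "a - b \<in> comm_ideal" "c - d \<in> comm_ideal"
  then have "(a - b) * c + b * (c - d) \<in> comm_ideal"
    by (intro comm_ideal_add comm_ideal.mult_left comm_ideal.mult_right)
  then show "a * c - b * d \<in> comm_ideal" by (simp add: algebra_simps)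
qed

instance
proof
  fix a b c :: Rt
  show "a + b + c = a + (b + c)"
    by transfer (simp add: ideal_cong_def comm_ideal.zero algebra_simps)
  show "a + b = b + a"
    by transfer (simp add: ideal_cong_def comm_ideal.zero algebra_simps)
  show "0 + a = a"
    by transfer (simp add: ideal_cong_def comm_ideal.zero)
  show "- a + a = 0"
    by transfer (simp add: ideal_cong_def comm_ideal.zero)
  show "a - b = a + - b"
    by transfer (simp add: ideal_cong_def comm_ideal.zero)
  show "a * b * c = a * (b * c)"
    by transfer (simp add: ideal_cong_def comm_ideal.zero mult.assoc)
  show "(a + b) * c = a * c + b * c"
    by transfer (simp add: ideal_cong_def comm_ideal.zero distrib_right)
  show "a * (b + c) = a * b + a * c"
    by transfer (simp add: ideal_cong_def comm_ideal.zero distrib_left)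
  show "1 * a = a"
    by transfer (simp add: ideal_cong_def comm_ideal.zero)
  show "a * 1 = a"
    by transfer (simp add: ideal_cong_def comm_ideal.zero)
  show "(0::Rt) \<noteq> 1"
  proof (transfer, unfold ideal_cong_def, rule notI)
    assume "(0::free_ring) - 1 \<in> comm_ideal"
    then have "augmentation (0 - 1) = 0" by (rule augmentation_comm_ideal)
    moreover have "augmentation 1 = 1" by (metis lin_ext_frag_of single_one)
    ultimately show False by (simp add: lin_ext_uminus)
  qed
qed

end

lift_definition t_gen :: Rt is "free_letter Let_t" .

lift_definition y_gen :: "nat \<Rightarrow> Rt" is "\<lambda>i. free_letter (Let_y i)" .

lemma y_commute: "y_gen i * y_gen j = y_gen j * y_gen i"
  by transfer (simp add: ideal_cong_def comm_ideal.gen)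

fun letter_deriv :: "letter \<Rightarrow> free_ring" where
  "letter_deriv Let_t = 0"
| "letter_deriv (Let_y i) = free_letter (Let_y (Suc i))"

fun word_deriv :: "letter list \<Rightarrow> free_ring" where
  "word_deriv [] = 0"
| "word_deriv (a # w) = letter_deriv a * frag_of (Word w) + free_letter a * word_deriv w"

abbreviation free_deriv :: "free_ring \<Rightarrow> free_ring" where
  "free_deriv \<equiv> lin_ext (\<lambda>w. word_deriv (letters w))"

lemma frag_of_Word_append: "frag_of (Word (v @ w)) = frag_of (Word v) * frag_of (Word w)"
  by (simp add: mult_single plus_word_def)

lemma frag_of_Word_Cons: "frag_of (Word (a # w)) = free_letter a * frag_of (Word w)"
  using frag_of_Word_append[of "[a]" w] by (simp only: append.simps)

lemma frag_of_Word_Nil: "frag_of (Word []) = 1"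
  by (simp flip: zero_word_def)

lemma word_deriv_append:
  "word_deriv (v @ w) = word_deriv v * frag_of (Word w) + frag_of (Word v) * word_deriv w"
proof (induction v)
  case (Cons a v)
  show ?case
    by (simp add: Cons frag_of_Word_append frag_of_Word_Cons[of a v] algebra_simps)
qed (simp add: frag_of_Word_Nil)

lemma free_deriv_mult: "free_deriv (p * q) = free_deriv p * q + p * free_deriv q"
proof (induction p rule: frag_induction[OF subset_UNIV])
  case (2 u)
  show ?case
  proof (induction q rule: frag_induction[OF subset_UNIV])
    case (2 v)
    show ?case
      by (cases u; cases v) (simp add: mult_single plus_word_def word_deriv_append)
  qed (simp_all add: lin_ext_diff algebra_simps)
qed (simp_all add: lin_ext_diff algebra_simps)

lemma free_deriv_comm_ideal: "a \<in> comm_ideal \<Longrightarrow> free_deriv a \<in> comm_ideal"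
proof (induction rule: comm_ideal.induct)
  case (gen i j)
  let ?Y = "\<lambda>i. free_letter (Let_y i)"
  have "(?Y (Suc i) * ?Y j - ?Y j * ?Y (Suc i)) + (?Y i * ?Y (Suc j) - ?Y (Suc j) * ?Y i)
          \<in> comm_ideal"
    by (intro comm_ideal_add comm_ideal.gen)
  then show ?case
    by (simp add: lin_ext_diff free_deriv_mult frag_of_Word_Nil algebra_simps)
next
  case (mult_left a r)
  then show ?case
    by (simp add: free_deriv_mult comm_ideal_add comm_ideal.mult_left)
next
  case (mult_right a r)
  then show ?case
    by (simp add: free_deriv_mult comm_ideal_add comm_ideal.mult_right)
qed (simp_all add: lin_ext_diff comm_ideal.zero comm_ideal.diff)

lift_definition Delta :: "Rt \<Rightarrow> Rt" is free_deriv
  unfolding ideal_cong_def using free_deriv_comm_ideal by (metis lin_ext_diff)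

lemma Delta_add: "Delta (p + q) = Delta p + Delta q"
  by transfer (simp add: ideal_cong_def comm_ideal.zero lin_ext_add)

lemma Delta_mult: "Delta (p * q) = Delta p * q + p * Delta q"
  by transfer (simp add: ideal_cong_def comm_ideal.zero free_deriv_mult)

lemma Delta_y: "Delta (y_gen i) = y_gen (i + 1)"
  by transfer (simp add: ideal_cong_def comm_ideal.zero frag_of_Word_Nil)

lemma Delta_t: "Delta t_gen = 0"
  by transfer (simp add: ideal_cong_def comm_ideal.zero frag_of_Word_Nil)

lemma Delta_unique:
  assumes add: "\<And>p q. D (p + q) = D p + D q"
    and mult: "\<And>p q. D (p * q) = D p * q + p * D q"
    and D_y: "\<And>i. D (y_gen i) = y_gen (i + 1)" and D_t: "D t_gen = 0"
  shows "D = Delta"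
proof
  have D0: "D 0 = 0" using add[of 0 0] by simp
  have D1: "D 1 = 0" using mult[of 1 1] by simp
  have Ddiff: "D (p - q) = D p - D q" for p q
    using add[of "p - q" q] by (simp add: algebra_simps)
  have Delta0: "Delta 0 = 0" using Delta_add[of 0 0] by simp
  have Delta1: "Delta 1 = 0" using Delta_mult[of 1 1] by simp
  have Deltadiff: "Delta (p - q) = Delta p - Delta q" for p q
    using Delta_add[of "p - q" q] by (simp add: algebra_simps)
  have word: "D (abs_Rt (frag_of (Word w))) = Delta (abs_Rt (frag_of (Word w)))" for w
  proof (induction w)
    case Nil
    then show ?case by (simp add: frag_of_Word_Nil D1 Delta1 flip: one_Rt_def one_Rt.abs_eq)
  next
    case (Cons a w)
    have "D (abs_Rt (free_letter a)) = Delta (abs_Rt (free_letter a))"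
      by (cases a) (simp_all add: D_y D_t Delta_y Delta_t flip: t_gen.abs_eq y_gen.abs_eq)
    then show ?case
      by (simp add: frag_of_Word_Cons[of a w] mult Delta_mult Cons flip: times_Rt.abs_eq)
  qed
  have "D (abs_Rt p) = Delta (abs_Rt p)" for p
  proof (induction p rule: frag_induction[OF subset_UNIV])
    case (2 u)
    show ?case using word by (cases u) simp
  qed (simp_all add: D0 Delta0 Ddiff Deltadiff flip: zero_Rt.abs_eq minus_Rt.abs_eq)
  then show "D p = Delta p" for p
    by (induction p rule: Rt.abs_induct)
qed

fun U :: "nat \<Rightarrow> nat \<Rightarrow> Rt" where
  "U 0 d = 1"
| "U (Suc n) d = y_gen 0 * ((\<lambda>u. Delta u + u * t_gen) ^^ d) (U n d)"

text \<open>
  Polynomials in \<open>x\<^sub>0, x\<^sub>1, \<dots>\<close>; a monomial is the finitely supported function of its exponents.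
\<close>

type_synonym xpoly = "(nat \<Rightarrow>\<^sub>0 nat) \<Rightarrow>\<^sub>0 int"

definition x_var :: "nat \<Rightarrow> xpoly" where
  "x_var i = frag_of (Poly_Mapping.single i 1)"

text \<open>
  The image \<open>y\<^bsub>\<alpha> n\<^esub> \<dots> y\<^bsub>\<alpha> 1\<^esub> t\<^bsup>\<alpha> 0\<^esup>\<close> of the monomial with exponents \<open>\<alpha>\<close>, in this order.
\<close>

definition monomial_image :: "nat \<Rightarrow> (nat \<Rightarrow>\<^sub>0 nat) \<Rightarrow> Rt" where
  "monomial_image n \<alpha> =
     (\<Prod>i\<leftarrow>rev [1..<n + 1]. y_gen (Poly_Mapping.lookup \<alpha> i)) * t_gen ^ Poly_Mapping.lookup \<alpha> 0"

text \<open>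
  The intended domain of \<open>umbral n\<close> is \<open>\<int>[x\<^sub>0, \<dots>, x\<^sub>n]\<close>, seen inside the ring of polynomials in all
  the \<open>x\<^sub>i\<close>; its values on polynomials involving further variables are irrelevant.
\<close>

definition umbral :: "nat \<Rightarrow> xpoly \<Rightarrow> Rt" where
  "umbral n = lin_ext (monomial_image n)"

definition PD :: "nat \<Rightarrow> nat \<Rightarrow> (nat \<times> nat \<rightharpoonup> nat) set" where
  "PD n d = {f. dom f \<subseteq> {1..n} \<times> {1..d} \<and> ran f \<subseteq> {1..n} \<and>
               (\<forall>i j. (i, j) \<in> dom f \<longrightarrow> the (f (i, j)) < i)}"

text \<open>
  A rooted tree is given by its arcs \<open>(i, j)\<close> with \<open>i\<close> the father of \<open>j\<close>.
\<close>

definition rooted_tree :: "nat set \<Rightarrow> nat \<Rightarrow> (nat \<times> nat) set \<Rightarrow> bool" where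
  "rooted_tree V r T \<longleftrightarrow>
     r \<in> V \<and> T \<subseteq> V \<times> V \<and>
     (\<forall>i. (i, r) \<notin> T) \<and>
     (\<forall>j\<in>V - {r}. \<exists>!i. (i, j) \<in> T) \<and>
     (\<forall>j\<in>V. (r, j) \<in> T\<^sup>*)"

definition increasing_trees :: "nat \<Rightarrow> (nat \<times> nat) set set" where
  "increasing_trees n = {T. rooted_tree {0..n} 0 T \<and> (\<forall>(i, j)\<in>T. i < j)}"

definition ch :: "nat \<Rightarrow> (nat \<times> nat) set \<Rightarrow> nat" where
  "ch i T = card {j. (i, j) \<in> T}"

text \<open>The \<open>d\<close>-tuples are functions on \<open>{1..d}\<close>, undefined elsewhere.\<close>

definition tree_tuples :: "nat \<Rightarrow> nat \<Rightarrow> (nat \<Rightarrow> (nat \<times> nat) set) set" where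
  "tree_tuples n d = {1..d} \<rightarrow>\<^sub>E increasing_trees n"

definition ch_tuple :: "nat \<Rightarrow> nat \<Rightarrow> (nat \<Rightarrow> (nat \<times> nat) set) \<Rightarrow> nat" where
  "ch_tuple d i F = (\<Sum>j = 1..d. ch i (F j))"

end

theory Submission
  imports Defs
begin

text \<open>
  Each of the three expressions is a sum over the maps \<open>h\<close> that assign to every
  \<open>(i, j) \<in> [n] \<times> [d]\<close> a value \<open>h (i, j) \<in> {0, \<dots>, i - 1}\<close>, where \<open>h\<close> contributes
  \<open>y\<^bsub>c 1\<^esub> \<dots> y\<^bsub>c n\<^esub> t\<^bsup>c 0\<^esup>\<close> with \<open>c k = #h\<^sup>-\<^sup>1(k)\<close>. For the first one, this is what
  multiplying out \<open>\<Prod>\<^sub>i (x\<^sub>0 + \<dots> + x\<^sub>i)\<^sup>d\<close> means: \<open>h\<close> records the variable chosen in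
  every factor (lemmas \<open>xproduct_expand\<close> and \<open>umbral_xproduct\<close>). For the second one, \<open>h\<close> is a
  partial map with \<open>0\<close> in the role of \<^emph>\<open>undefined\<close> (\<open>sum_PD\<close>). For the third one,
  \<open>h (i, j)\<close> is the father of the node \<open>i\<close> in the \<open>j\<close>-th tree: since fathers have smaller
  labels, every choice of fathers gives an increasing tree (\<open>sum_tree_tuples\<close>).

  That \<open>U\<^sub>n\<close> equals these sums is clear in the umbral picture. By the Leibniz rule, \<open>\<Delta>\<close> raises one
  index of \<open>y\<^bsub>\<alpha> n\<^esub> \<dots> y\<^bsub>\<alpha> 1\<^esub> t\<^sup>k\<close> at a time, so it corresponds to multiplication by
  \<open>x\<^sub>1 + \<dots> + x\<^sub>n\<close>, while right multiplication by \<open>t\<close> corresponds to multiplication by \<open>x\<^sub>0\<close>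
  (\<open>umbral_mult_var_sum\<close>). Thus \<open>(\<Delta> + \<rho>\<^sub>t)\<^sup>d\<close> contributes the factor
  \<open>(x\<^sub>0 + \<dots> + x\<^sub>n)\<^sup>d\<close>. Multiplication by \<open>y\<^sub>0\<close> on the left is the passage from \<open>n\<close> to \<open>n + 1\<close>
  variables, because the product obtained so far does not involve \<open>x\<^bsub>n+1\<^esub>\<close>.
\<close>

section \<open>The umbral map turns multiplication into the operator\<close>

lemma lin_ext_sum: "lin_ext g (\<Sum>a\<in>A. p a) = (\<Sum>a\<in>A. lin_ext g (p a))"
  by (induction A rule: infinite_finite_induct) (simp_all add: lin_ext_add)

lemma monomial_image_Suc:
  "monomial_image (Suc n) \<alpha> = y_gen (Poly_Mapping.lookup \<alpha> (Suc n)) * monomial_image n \<alpha>"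
  by (simp add: monomial_image_def mult.assoc)

lemma monomial_image_cong:
  assumes "\<And>i. i \<le> n \<Longrightarrow> Poly_Mapping.lookup \<alpha> i = Poly_Mapping.lookup \<beta> i"
  shows "monomial_image n \<alpha> = monomial_image n \<beta>"
  using assms by (induction n) (auto simp: monomial_image_Suc, simp add: monomial_image_def)

lemma Delta_0: "Delta 0 = 0"
  using Delta_add[of 0 0] by simp

lemma Delta_power_t: "Delta (t_gen ^ k) = 0"
proof (induction k)
  case 0
  show ?case using Delta_mult[of 1 1] by simp
qed (simp add: Delta_mult Delta_t)

lemma Delta_monomial_image:
  "Delta (monomial_image n \<alpha>) = (\<Sum>j=1..n. monomial_image n (Poly_Mapping.single j 1 + \<alpha>))"
proof (induction n)
  case 0
  show ?case by (simp add: monomial_image_def Delta_power_t)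
next
  case (Suc n)
  have "monomial_image n (Poly_Mapping.single (Suc n) 1 + \<alpha>) = monomial_image n \<alpha>"
    by (rule monomial_image_cong) (simp add: lookup_add lookup_single)
  then show ?case
    by (simp add: monomial_image_Suc Delta_mult Delta_y Suc sum_distrib_left lookup_add
        lookup_single add.commute)
qed

lemma monomial_image_mult_t:
  "monomial_image n \<alpha> * t_gen = monomial_image n (Poly_Mapping.single 0 1 + \<alpha>)"
  by (induction n)
    (simp_all add: monomial_image_Suc mult.assoc lookup_add lookup_single,
      simp add: monomial_image_def lookup_add power_commutes)

text \<open>
  Both sides are additive in \<open>p\<close>, so it is enough to take a monomial; there the summands with
  \<open>j \<ge> 1\<close> are the terms of the Leibniz rule and the summand with \<open>j = 0\<close> is the extra \<open>t\<close>.
\<close>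

lemma umbral_mult_var_sum:
  "umbral n ((\<Sum>j\<le>n. x_var j) * p) = Delta (umbral n p) + umbral n p * t_gen"
proof (induction p rule: frag_induction[OF subset_UNIV])
  case 1
  show ?case by (simp add: umbral_def Delta_0)
next
  case (2 \<alpha>)
  have "umbral n ((\<Sum>j\<le>n. x_var j) * frag_of \<alpha>)
      = (\<Sum>j\<le>n. monomial_image n (Poly_Mapping.single j 1 + \<alpha>))"
    by (simp add: umbral_def x_var_def sum_distrib_right lin_ext_sum mult_single)
  also have "\<dots> = (\<Sum>j=1..n. monomial_image n (Poly_Mapping.single j 1 + \<alpha>))
      + monomial_image n (Poly_Mapping.single 0 1 + \<alpha>)"
    by (simp add: sum.atLeast1_atMost_eq sum.atMost_shift atLeast0AtMost lessThan_Suc_atMost)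
  finally show ?case
    by (simp add: umbral_def Delta_monomial_image monomial_image_mult_t)
next
  case (3 p q)
  have "Delta (umbral n p - umbral n q) = Delta (umbral n p) - Delta (umbral n q)"
    using Delta_add[of "umbral n p - umbral n q" "umbral n q"] by (simp add: algebra_simps)
  with 3 show ?case
    by (simp add: umbral_def lin_ext_diff right_diff_distrib left_diff_distrib)
qed

lemma umbral_mult_var_sum_power:
  "umbral n ((\<Sum>j\<le>n. x_var j) ^ d * p) = ((\<lambda>u. Delta u + u * t_gen) ^^ d) (umbral n p)"
  by (induction d) (simp_all add: mult.assoc umbral_mult_var_sum)

section \<open>Multiplying out the product\<close>

text \<open>
  The factors of the product are numbered by \<open>i \<in> [n]\<close> instead of \<open>i < n\<close>, so that the choices
  in the \<open>i\<close>-th factor are the labels that the father of the node \<open>i\<close> may have.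
\<close>

definition father_maps :: "nat \<Rightarrow> nat \<Rightarrow> (nat \<times> nat \<Rightarrow> nat) set" where
  "father_maps n d = Pi\<^sub>E ({1..n} \<times> {1..d}) (\<lambda>(i, j). {..<i})"

definition fibre_card :: "nat \<Rightarrow> nat \<Rightarrow> (nat \<times> nat \<Rightarrow> nat) \<Rightarrow> nat \<Rightarrow> nat" where
  "fibre_card n d h k = card {p \<in> {1..n} \<times> {1..d}. h p = k}"

definition fibre_weight :: "nat \<Rightarrow> nat \<Rightarrow> (nat \<times> nat \<Rightarrow> nat) \<Rightarrow> Rt" where
  "fibre_weight n d h =
     (\<Prod>i\<leftarrow>[1..<n + 1]. y_gen (fibre_card n d h i)) * t_gen ^ fibre_card n d h 0"

definition fibre_exponents :: "nat \<Rightarrow> nat \<Rightarrow> (nat \<times> nat \<Rightarrow> nat) \<Rightarrow> nat \<Rightarrow>\<^sub>0 nat" where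
  "fibre_exponents n d h = (\<Sum>p\<in>{1..n} \<times> {1..d}. Poly_Mapping.single (h p) 1)"

lemma lookup_fibre_exponents:
  "Poly_Mapping.lookup (fibre_exponents n d h) k = fibre_card n d h k"
  by (simp add: fibre_exponents_def fibre_card_def lookup_sum lookup_single when_def
      sum.If_cases Int_def)

lemma prod_x_var:
  "(\<Prod>a\<in>A. x_var (g a)) = frag_of (\<Sum>a\<in>A. Poly_Mapping.single (g a) 1)"
  by (induction A rule: infinite_finite_induct) (simp_all add: x_var_def mult_single)

lemma xproduct_expand:
  "(\<Prod>i<n. (\<Sum>j\<le>i. x_var j) ^ d) = (\<Sum>h\<in>father_maps n d. frag_of (fibre_exponents n d h))"
proof -
  have "(\<Prod>i<n. (\<Sum>j\<le>i. x_var j) ^ d) = (\<Prod>i=1..n. \<Prod>j=1..d. \<Sum>k<i. x_var k)"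
    by (simp add: prod.atLeast1_atMost_eq lessThan_Suc_atMost)
  also have "\<dots> = (\<Prod>p\<in>{1..n} \<times> {1..d}. \<Sum>k\<in>(case p of (i, j) \<Rightarrow> {..<i}). x_var k)"
    unfolding prod.cartesian_product by (rule prod.cong) auto
  also have "\<dots> = (\<Sum>h\<in>father_maps n d. \<Prod>p\<in>{1..n} \<times> {1..d}. x_var (h p))"
    unfolding father_maps_def by (rule prod_sum_PiE) auto
  finally show ?thesis by (simp only: prod_x_var fibre_exponents_def)
qed

lemma fibre_card_top:
  assumes "h \<in> father_maps (Suc n) d"
  shows "fibre_card (Suc n) d h (Suc n) = 0"
proof -
  have "h p \<noteq> Suc n" if "p \<in> {1..Suc n} \<times> {1..d}" for p
    using assms that by (force simp: father_maps_def dest: PiE_mem)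
  then show ?thesis by (auto simp: fibre_card_def)
qed

text \<open>
  No factor involves the last variable \<open>x\<^bsub>n+1\<^esub>\<close>, and its zeroth power is replaced
  by \<open>y\<^sub>0\<close>.
\<close>

lemma umbral_Suc_xproduct:
  "umbral (Suc n) (\<Prod>i<Suc n. (\<Sum>j\<le>i. x_var j) ^ d)
     = y_gen 0 * umbral n (\<Prod>i<Suc n. (\<Sum>j\<le>i. x_var j) ^ d)"
  by (simp add: xproduct_expand umbral_def lin_ext_sum sum_distrib_left monomial_image_Suc
      lookup_fibre_exponents fibre_card_top del: prod.lessThan_Suc)

lemma U_eq_umbral: "U n d = umbral n (\<Prod>i<n. (\<Sum>j\<le>i. x_var j) ^ d)"
proof (induction n)
  case 0
  have "umbral 0 1 = monomial_image 0 0"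
    by (metis umbral_def lin_ext_frag_of single_one)
  then show ?case by (simp add: monomial_image_def)
next
  case (Suc n)
  then show ?case
    by (simp add: umbral_Suc_xproduct mult.commute del: prod.lessThan_Suc)
      (simp add: mult.commute flip: umbral_mult_var_sum_power)
qed

text \<open>
  The umbral map writes the \<open>y\<close>'s with decreasing indices, the two combinatorial sums with
  increasing ones. In the noncommutative ring \<open>R\<langle>t\<rangle>\<close> this needs the relations between the \<open>y\<close>'s.
\<close>

lemma prod_list_y_gen_rev:
  "(\<Prod>i\<leftarrow>rev is. y_gen (c i)) = (\<Prod>i\<leftarrow>is. y_gen (c i))"
proof (induction "is")
  case (Cons a "is")
  have "prod_list (map (\<lambda>i. y_gen (c i)) is) * y_gen k
      = y_gen k * prod_list (map (\<lambda>i. y_gen (c i)) is)" for k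
    by (induction "is") (simp_all, metis mult.assoc y_commute)
  with Cons show ?case by simp
qed simp

lemma umbral_xproduct:
  "umbral n (\<Prod>i<n. (\<Sum>j\<le>i. x_var j) ^ d) = (\<Sum>h\<in>father_maps n d. fibre_weight n d h)"
  by (simp add: xproduct_expand umbral_def lin_ext_sum monomial_image_def prod_list_y_gen_rev
      lookup_fibre_exponents fibre_weight_def del: upt_Suc)

section \<open>Partial maps\<close>

definition map_of_father_map :: "nat \<Rightarrow> nat \<Rightarrow> (nat \<times> nat \<Rightarrow> nat) \<Rightarrow> nat \<times> nat \<rightharpoonup> nat" where
  "map_of_father_map n d h =
     (\<lambda>p. if p \<in> {1..n} \<times> {1..d} \<and> h p \<noteq> 0 then Some (h p) else None)"

lemma bij_betw_map_of_father_map: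
  "bij_betw (map_of_father_map n d) (father_maps n d) (PD n d)"
proof (rule bij_betw_byWitness[where f' =
      "\<lambda>f. restrict (\<lambda>p. case f p of None \<Rightarrow> 0 | Some k \<Rightarrow> k) ({1..n} \<times> {1..d})"])
  show "\<forall>h\<in>father_maps n d. restrict (\<lambda>p. case map_of_father_map n d h p of None \<Rightarrow> 0 | Some k \<Rightarrow> k)
      ({1..n} \<times> {1..d}) = h"
    by (auto simp: father_maps_def map_of_father_map_def fun_eq_iff restrict_def PiE_def
        extensional_def)
  have "map_of_father_map n d
      (restrict (\<lambda>p. case f p of None \<Rightarrow> 0 | Some k \<Rightarrow> k) ({1..n} \<times> {1..d})) p = f p"
    if f: "f \<in> PD n d" for f p
  proof (cases "f p")
    case None
    then show ?thesis by (auto simp: map_of_father_map_def)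
  next
    case (Some k)
    then have "p \<in> {1..n} \<times> {1..d}" "k \<in> {1..n}"
      using f by (auto simp: PD_def dest: ranI)
    with Some show ?thesis by (auto simp: map_of_father_map_def)
  qed
  then show "\<forall>f\<in>PD n d. map_of_father_map n d
      (restrict (\<lambda>p. case f p of None \<Rightarrow> 0 | Some k \<Rightarrow> k) ({1..n} \<times> {1..d})) = f"
    by blast
  have "h (i, j) < i" if "h \<in> father_maps n d" "i \<in> {1..n}" "j \<in> {1..d}" for h i j
    using that by (auto simp: father_maps_def dest: PiE_mem)
  then show "map_of_father_map n d ` father_maps n d \<subseteq> PD n d"
    by (fastforce simp: PD_def map_of_father_map_def dom_def ran_def split: if_splits)
  have "(case f (i, j) of None \<Rightarrow> 0 | Some k \<Rightarrow> k) < i"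
    if "f \<in> PD n d" "i \<in> {1..n}" for f i j
    using that by (force simp: PD_def split: option.split)
  then show "(\<lambda>f. restrict (\<lambda>p. case f p of None \<Rightarrow> 0 | Some k \<Rightarrow> k) ({1..n} \<times> {1..d})) ` PD n d
      \<subseteq> father_maps n d"
    by (auto simp: father_maps_def image_subset_iff restrict_PiE_iff)
qed

lemma card_vimage_map_of_father_map:
  assumes "i \<ge> 1"
  shows "card (map_of_father_map n d h -` {Some i}) = fibre_card n d h i"
  using assms unfolding fibre_card_def map_of_father_map_def
  by (intro arg_cong[where f = card]) (auto split: if_splits)

lemma card_dom_map_of_father_map:
  "n * d - card (dom (map_of_father_map n d h)) = fibre_card n d h 0"
proof -
  let ?A = "{1..n} \<times> {1..d}"
  have "card ?A - card (dom (map_of_father_map n d h)) = card (?A - dom (map_of_father_map n d h))"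
    by (rule card_Diff_subset[symmetric])
      (auto simp: map_of_father_map_def dom_def split: if_splits intro: finite_subset[of _ ?A])
  also have "?A - dom (map_of_father_map n d h) = {p \<in> ?A. h p = 0}"
    by (auto simp: map_of_father_map_def)
  finally show ?thesis by (simp add: fibre_card_def)
qed

lemma sum_PD:
  "(\<Sum>f\<in>PD n d. (\<Prod>i\<leftarrow>[1..<n + 1]. y_gen (card (f -` {Some i}))) * t_gen ^ (n * d - card (dom f)))
     = (\<Sum>h\<in>father_maps n d. fibre_weight n d h)"
proof -
  have "map (\<lambda>i. y_gen (card (map_of_father_map n d h -` {Some i}))) [1..<n + 1]
      = map (\<lambda>i. y_gen (fibre_card n d h i)) [1..<n + 1]" for h
    by (rule map_cong) (auto simp: card_vimage_map_of_father_map)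
  then show ?thesis
    by (simp only: sum.reindex_bij_betw[OF bij_betw_map_of_father_map, symmetric]
        fibre_weight_def card_dom_map_of_father_map)
qed

section \<open>Tuples of increasing trees\<close>

definition arcs :: "nat \<Rightarrow> (nat \<Rightarrow> nat) \<Rightarrow> (nat \<times> nat) set" where
  "arcs n \<phi> = (\<lambda>i. (\<phi> i, i)) ` {1..n}"

lemma mem_arcs_iff: "(k, i) \<in> arcs n \<phi> \<longleftrightarrow> i \<in> {1..n} \<and> k = \<phi> i"
  by (auto simp: arcs_def)

text \<open>
  Every node is reachable from the root by strong induction on its label, since its father is
  smaller.
\<close>

lemma arcs_increasing_tree:
  assumes \<phi>: "\<And>i. i \<in> {1..n} \<Longrightarrow> \<phi> i < i"
  shows "arcs n \<phi> \<in> increasing_trees n"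
proof -
  have reach: "(0, i) \<in> (arcs n \<phi>)\<^sup>*" if "i \<le> n" for i
    using that
  proof (induction i rule: less_induct)
    case (less i)
    show ?case
    proof (cases "i = 0")
      case False
      then have i: "i \<in> {1..n}" using less.prems by auto
      then have "(0, \<phi> i) \<in> (arcs n \<phi>)\<^sup>*" using less.IH[of "\<phi> i"] \<phi>[of i] by auto
      moreover have "(\<phi> i, i) \<in> arcs n \<phi>" using i by (simp add: mem_arcs_iff)
      ultimately show ?thesis by (rule rtrancl_into_rtrancl)
    qed simp
  qed
  have "arcs n \<phi> \<subseteq> {0..n} \<times> {0..n}"
    using \<phi> by (fastforce simp: arcs_def)
  moreover have "\<exists>!k. (k, i) \<in> arcs n \<phi>" if "i \<in> {0..n} - {0}" for i
    using that by (auto simp: mem_arcs_iff)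
  moreover have "k < i" if "(k, i) \<in> arcs n \<phi>" for k i
    using that \<phi> by (auto simp: mem_arcs_iff)
  ultimately show ?thesis
    using reach by (auto simp: increasing_trees_def rooted_tree_def mem_arcs_iff)
qed

lemma increasing_tree_eq_arcs:
  assumes "T \<in> increasing_trees n"
  shows "T = arcs n (\<lambda>i. THE k. (k, i) \<in> T)" and "\<And>i. i \<in> {1..n} \<Longrightarrow> (THE k. (k, i) \<in> T) < i"
proof -
  have T: "T \<subseteq> {0..n} \<times> {0..n}" "\<And>k. (k, 0) \<notin> T"
    "\<And>i. i \<in> {1..n} \<Longrightarrow> \<exists>!k. (k, i) \<in> T" "\<And>k i. (k, i) \<in> T \<Longrightarrow> k < i"
    using assms by (auto simp: increasing_trees_def rooted_tree_def)
  have dom: "i \<in> {1..n}" if "(k, i) \<in> T" for k i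
    using that T(1,4) by fastforce
  have the: "((THE k. (k, i) \<in> T), i) \<in> T" if "i \<in> {1..n}" for i
    by (rule theI') (rule T(3)[OF that])
  have "(k, i) \<in> T \<longleftrightarrow> (k, i) \<in> arcs n (\<lambda>i. THE k. (k, i) \<in> T)" for k i
    using dom[of k i] the[of i] T(3)[of i] unfolding mem_arcs_iff by blast
  then show "T = arcs n (\<lambda>i. THE k. (k, i) \<in> T)" by (intro equalityI subrelI) blast+
  show "(THE k. (k, i) \<in> T) < i" if "i \<in> {1..n}" for i
    using T(4) the[OF that] by blast
qed

definition forest_of_father_map ::
    "nat \<Rightarrow> nat \<Rightarrow> (nat \<times> nat \<Rightarrow> nat) \<Rightarrow> nat \<Rightarrow> (nat \<times> nat) set" where
  "forest_of_father_map n d h = restrict (\<lambda>j. arcs n (\<lambda>i. h (i, j))) {1..d}"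

lemma bij_betw_forest_of_father_map:
  "bij_betw (forest_of_father_map n d) (father_maps n d) (tree_tuples n d)"
proof (rule bij_betw_byWitness[where f' =
      "\<lambda>F. restrict (\<lambda>(i, j). THE k. (k, i) \<in> F j) ({1..n} \<times> {1..d})"])
  show "\<forall>h\<in>father_maps n d. restrict (\<lambda>(i, j). THE k. (k, i) \<in> forest_of_father_map n d h j)
      ({1..n} \<times> {1..d}) = h"
    by (auto simp: father_maps_def forest_of_father_map_def fun_eq_iff restrict_def PiE_def
        extensional_def mem_arcs_iff)
  have "forest_of_father_map n d
      (restrict (\<lambda>(i, j). THE k. (k, i) \<in> F j) ({1..n} \<times> {1..d})) j = F j"
    if F: "F \<in> tree_tuples n d" for F j
  proof (cases "j \<in> {1..d}")
    case True
    then have "F j \<in> increasing_trees n" using F by (auto simp: tree_tuples_def)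
    then have "F j = arcs n (\<lambda>i. THE k. (k, i) \<in> F j)" by (rule increasing_tree_eq_arcs(1))
    also have "\<dots> = arcs n (\<lambda>i. restrict (\<lambda>(i, j). THE k. (k, i) \<in> F j) ({1..n} \<times> {1..d}) (i, j))"
      using True by (auto simp: arcs_def)
    finally show ?thesis using True by (simp add: forest_of_father_map_def)
  next
    case False
    then show ?thesis
      using F unfolding tree_tuples_def forest_of_father_map_def by (simp add: PiE_arb[of F]
          del: atLeastAtMost_iff)
  qed
  then show "\<forall>F\<in>tree_tuples n d. forest_of_father_map n d
      (restrict (\<lambda>(i, j). THE k. (k, i) \<in> F j) ({1..n} \<times> {1..d})) = F"
    by blast
  have "h (i, j) < i" if "h \<in> father_maps n d" "i \<in> {1..n}" "j \<in> {1..d}" for h i j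
    using that by (auto simp: father_maps_def dest: PiE_mem)
  then show "forest_of_father_map n d ` father_maps n d \<subseteq> tree_tuples n d"
    by (auto simp: tree_tuples_def forest_of_father_map_def intro!: arcs_increasing_tree)
  have "(THE k. (k, i) \<in> F j) < i"
    if "F \<in> tree_tuples n d" "i \<in> {1..n}" "j \<in> {1..d}" for F i j
    using that by (intro increasing_tree_eq_arcs(2)) (auto simp: tree_tuples_def)
  then show "(\<lambda>F. restrict (\<lambda>(i, j). THE k. (k, i) \<in> F j) ({1..n} \<times> {1..d})) ` tree_tuples n d
      \<subseteq> father_maps n d"
    by (auto simp: father_maps_def image_subset_iff restrict_PiE_iff)
qed

lemma ch_tuple_forest_of_father_map:
  "ch_tuple d k (forest_of_father_map n d h) = fibre_card n d h k"
proof -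
  have "ch_tuple d k (forest_of_father_map n d h) = (\<Sum>j=1..d. card {i \<in> {1..n}. h (i, j) = k})"
    unfolding ch_tuple_def ch_def forest_of_father_map_def
    by (intro sum.cong arg_cong[where f = card]) (auto simp: mem_arcs_iff)
  also have "\<dots> = card (SIGMA j:{1..d}. {i \<in> {1..n}. h (i, j) = k})"
    by simp
  also have "\<dots> = card {p \<in> {1..n} \<times> {1..d}. h p = k}"
    by (rule bij_betw_same_card[of prod.swap])
      (auto intro!: bij_betw_byWitness[where f' = prod.swap])
  finally show ?thesis by (simp add: fibre_card_def)
qed

lemma sum_tree_tuples:
  "(\<Sum>F\<in>tree_tuples n d. (\<Prod>i\<leftarrow>[1..<n + 1]. y_gen (ch_tuple d i F)) * t_gen ^ ch_tuple d 0 F)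
     = (\<Sum>h\<in>father_maps n d. fibre_weight n d h)"
  by (simp add: sum.reindex_bij_betw[OF bij_betw_forest_of_father_map, symmetric]
      fibre_weight_def ch_tuple_forest_of_father_map del: upt_Suc)

theorem theorem6p5:
  fixes n d :: nat
  assumes "d \<ge> 1"
  shows "U n d = umbral n (\<Prod>i<n. (\<Sum>j\<le>i. x_var j) ^ d)
    \<and> U n d = (\<Sum>f\<in>PD n d.
          (\<Prod>i\<leftarrow>[1..<n + 1]. y_gen (card (f -` {Some i}))) * t_gen ^ (n * d - card (dom f)))
    \<and> U n d = (\<Sum>F\<in>tree_tuples n d.
          (\<Prod>i\<leftarrow>[1..<n + 1]. y_gen (ch_tuple d i F)) * t_gen ^ ch_tuple d 0 F)"
  by (simp only: sum_PD sum_tree_tuples umbral_xproduct U_eq_umbral simp_thms)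

end
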